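(* Let $N\in\mathbb{N}$ with $N\ge 1$ and $t=\lfloor (N-1)/2\rfloor$. Let $R_N$ be the positive root of the equation $2(1+r)r^N-(1-r)^2=0$ and let $R_N'$ be the positive root of the equation $(1+r)r^N-(1-r)^2=0$. Then for every $f\in\mathcal{B}$ with $f(z)=\sum_{n=0}^{\infty}a_nz^n$: $$|f(z)|+\sum_{n=N}^{\infty}|a_n|r^n+\operatorname{sgn}(t)\sum_{n=1}^{t}|a_n|^2\frac{r^N}{1-r}+\left(\frac{1}{1+|a_0|}+\frac{r}{1-r}\right)\sum_{n=t+1}^{\infty}|a_n|^2r^{2n}\le 1\quad\text{for } |z|=r\le R_N,$$ and the radius $R_N$ is best possible. Moreover, $$|f(z)|^2+\sum_{n=N}^{\infty}|a_n|r^n+\operatorname{sgn}(t)\sum_{n=1}^{t}|a_n|^2\frac{r^N}{1-r}+\left(\frac{1}{1+|a_0|}+\frac{r}{1-r}\right)\sum_{n=t+1}^{\infty}|a_n|^2r^{2n}\le 1\quad\text{for } |z|=r\le R_N',$$ and the radius $R_N'$ is best possible.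
   Context: $\mathbb{D}=\{z\in\mathbb{C}:|z|<1\}$ and $\mathcal{B}$ is the set of all analytic functions $f:\mathbb{D}\to\mathbb{D}$. $\lfloor x\rfloor$ is the largest integer not exceeding $x$; $\operatorname{sgn}(0)=0$ and $\operatorname{sgn}(t)=1$ for $t>0$. "Best possible" means that the radius cannot be replaced by any larger number so that the corresponding inequality still holds for all $f\in\mathcal{B}$. *)

theory Defs
  imports "HOL-Complex_Analysis.Complex_Analysis"
begin

definition schur_class :: "(complex \<Rightarrow> complex) set" where
  "schur_class = {f. f analytic_on ball 0 1 \<and> f ` ball 0 1 \<subseteq> ball 0 1}"

definition disc_series :: "(complex \<Rightarrow> complex) \<Rightarrow> (nat \<Rightarrow> complex) \<Rightarrow> bool" where
  "disc_series f a \<longleftrightarrow> (\<forall>z \<in> ball 0 1. (\<lambda>n. a n * z ^ n) sums f z)"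

text \<open>For \<open>N \<ge> 1\<close>, the natural number \<open>(N - 1) div 2\<close> is the floor of \<open>(N - 1) / 2\<close>.
  The shifted series are the sums over \<open>n \<ge> N\<close> and \<open>n \<ge> t + 1\<close>; for the coefficients of a
  function in \<^const>\<open>schur_class\<close> they converge whenever \<open>0 \<le> r < 1\<close>.\<close>

definition refined_bohr_terms :: "nat \<Rightarrow> (nat \<Rightarrow> complex) \<Rightarrow> real \<Rightarrow> real" where
  "refined_bohr_terms N a r =
    (let t = (N - 1) div 2 in
      (\<Sum>n. cmod (a (n + N)) * r ^ (n + N))
      + sgn (real t) * (\<Sum>n = 1..t. (cmod (a n))\<^sup>2 * (r ^ N / (1 - r)))
      + (1 / (1 + cmod (a 0)) + r / (1 - r))
          * (\<Sum>n. (cmod (a (n + (t + 1))))\<^sup>2 * r ^ (2 * (n + (t + 1)))))"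

definition radius_R :: "nat \<Rightarrow> real" where
  "radius_R N = (THE r. r > 0 \<and> 2 * (1 + r) * r ^ N - (1 - r)\<^sup>2 = 0)"

definition radius_R' :: "nat \<Rightarrow> real" where
  "radius_R' N = (THE r. r > 0 \<and> (1 + r) * r ^ N - (1 - r)\<^sup>2 = 0)"

end

theory Submission
  imports Defs
begin

text \<open>Carlson's inequalities
  \<open>\<bar>a\<^bsub>2n+1\<^esub>\<bar> \<le> 1 - \<bar>a\<^sub>0\<bar>\<^sup>2 - \<dots> - \<bar>a\<^sub>n\<bar>\<^sup>2\<close> and
  \<open>\<bar>a\<^bsub>2n\<^esub>\<bar> \<le> 1 - \<bar>a\<^sub>0\<bar>\<^sup>2 - \<dots> - \<bar>a\<^bsub>n-1\<^esub>\<bar>\<^sup>2 - \<bar>a\<^sub>n\<bar>\<^sup>2 / (1 + \<bar>a\<^sub>0\<bar>)\<close>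
  follow from the fact that multiplication by \<open>f\<close> is a contraction of the Hardy space. Multiplying
  them by \<open>r\<^sup>n\<close> and summing over \<open>n \<ge> N\<close>, the square terms on the right collect to exactly the
  square terms of the refined Bohr sum, which is therefore at most \<open>(1 - \<bar>a\<^sub>0\<bar>\<^sup>2) r\<^sup>N / (1 - r)\<close>.
  Together with the Schwarz-Pick bound \<open>\<bar>f z\<bar> \<le> (r + \<bar>a\<^sub>0\<bar>) / (1 + \<bar>a\<^sub>0\<bar> r)\<close> this leaves an
  elementary inequality whose worst case is \<open>\<bar>a\<^sub>0\<bar> \<rightarrow> 1\<close>. The functions \<open>(z + c) / (1 + c z)\<close> with
  \<open>c \<rightarrow> 1\<close> are asymptotically extremal.\<close>

subsection \<open>Parseval's identity and the multiplier contraction\<close>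

lemma cis_orthonormal:
  fixes n k :: nat
  shows "((\<lambda>t. cis (2 * pi * n * t) * cnj (cis (2 * pi * k * t))) has_integral
           (if n = k then 1 else 0)) {0..1}"
proof (cases "n = k")
  case True
  have "((\<lambda>t::real. 1::complex) has_integral 1) {0..1}"
    using has_integral_const_real[of "1::complex" 0 1] by simp
  then show ?thesis using True by (simp add: cis_cnj cis_mult)
next
  case False
  define m where "m = 2 * pi * (real n - real k)"
  have m0: "m \<noteq> 0" using False by (simp add: m_def)
  have eq: "cis (2 * pi * n * t) * cnj (cis (2 * pi * k * t)) = cis (m * t)" for t
    by (simp add: cis_cnj cis_mult m_def algebra_simps)
  have D: "((\<lambda>t. cis (m * t) / (\<i> * m)) has_vector_derivative cis (m * t)) (at t within {0..1})" for t
  proof -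
    have "((\<lambda>w. exp (\<i> * of_real m * w) / (\<i> * m)) has_field_derivative exp (\<i> * of_real m * of_real t))
           (at (of_real t))"
      using m0 by (auto intro!: derivative_eq_intros)
    from has_vector_derivative_real_field[OF this] show ?thesis
      by (simp add: cis_conv_exp mult.assoc)
  qed
  have "((\<lambda>t. cis (m * t)) has_integral (cis (m * 1) / (\<i> * m) - cis (m * 0) / (\<i> * m))) {0..1}"
    by (rule fundamental_theorem_of_calculus) (use D in auto)
  moreover have "cis m = 1"
  proof -
    have "cis (2 * pi * real_of_int (int n - int k)) = 1"
      by (rule cis_multiple_2pi) auto
    then show ?thesis by (simp add: m_def)
  qed
  ultimately show ?thesis using False by (simp add: eq)
qed

text \<open>The M-test makes the partial sums converge uniformly, so the series may be integrated
  termwise. The factor \<open>H\<close> is free because Parseval uses it twice: a conjugate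
  exponential extracts one coefficient, the conjugate of the whole sum gives the norm.\<close>

lemma has_integral_fourier_series_mult:
  fixes c I :: "nat \<Rightarrow> complex" and H :: "real \<Rightarrow> complex"
  assumes c: "summable (\<lambda>n. cmod (c n))" and H: "continuous_on {0..1} H"
    and I: "\<And>n. ((\<lambda>t. cis (2 * pi * n * t) * H t) has_integral I n) {0..1}"
  obtains J where "((\<lambda>t. (\<Sum>n. c n * cis (2 * pi * n * t)) * H t) has_integral J) {0..1}"
    and "(\<lambda>n. c n * I n) sums J"
proof -
  obtain B where B: "\<And>t. t \<in> {0..1} \<Longrightarrow> cmod (H t) \<le> B"
    using compact_continuous_image[OF H compact_Icc] compact_imp_bounded bounded_iff
    by (metis imageI)
  have summ: "summable (\<lambda>n. c n * cis (2 * pi * n * t))" for t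
    by (rule summable_norm_cancel) (use c in \<open>simp add: norm_mult\<close>)
  have "uniform_limit {0..1} (\<lambda>m t. \<Sum>n<m. c n * cis (2 * pi * n * t) * H t)
          (\<lambda>t. \<Sum>n. c n * cis (2 * pi * n * t) * H t) sequentially"
  proof (rule Weierstrass_m_test)
    show "cmod (c n * cis (2 * pi * n * t) * H t) \<le> cmod (c n) * B" if "t \<in> {0..1}" for n t
      using B[OF that] by (simp add: norm_mult mult_left_mono)
    show "summable (\<lambda>n. cmod (c n) * B)"
      using c by (rule summable_mult2)
  qed
  moreover have "(\<Sum>n. c n * cis (2 * pi * n * t) * H t) = (\<Sum>n. c n * cis (2 * pi * n * t)) * H t" for t
    using suminf_mult2[OF summ] by simp
  ultimately have "uniform_limit {0..1} (\<lambda>m t. \<Sum>n<m. c n * cis (2 * pi * n * t) * H t)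
          (\<lambda>t. (\<Sum>n. c n * cis (2 * pi * n * t)) * H t) sequentially"
    by simp
  then obtain S J where S: "\<And>m. ((\<lambda>t. \<Sum>n<m. c n * cis (2 * pi * n * t) * H t) has_integral S m) {0..1}"
    and J: "((\<lambda>t. (\<Sum>n. c n * cis (2 * pi * n * t)) * H t) has_integral J) {0..1}" "S \<longlonglongrightarrow> J"
  proof (rule uniform_limit_integral)
    show "continuous_on {0..1} (\<lambda>t. \<Sum>n<m. c n * cis (2 * pi * n * t) * H t)" for m
      by (intro continuous_intros H)
  qed auto
  have "((\<lambda>t. \<Sum>n<m. c n * cis (2 * pi * n * t) * H t) has_integral (\<Sum>n<m. c n * I n)) {0..1}" for m
  proof (rule has_integral_sum)
    show "((\<lambda>t. c n * cis (2 * pi * n * t) * H t) has_integral c n * I n) {0..1}" for n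
      using has_integral_mult_right[OF I[of n], of "c n"] by (simp add: mult.assoc)
  qed auto
  with S have "S = (\<lambda>m. \<Sum>n<m. c n * I n)"
    by (meson ext has_integral_unique)
  then show thesis using J that by (simp add: sums_def)
qed

lemma parseval_abs_summable:
  fixes c :: "nat \<Rightarrow> complex"
  assumes c: "summable (\<lambda>n. cmod (c n))"
  obtains J where "((\<lambda>t. (cmod (\<Sum>n. c n * cis (2 * pi * n * t)))\<^sup>2) has_integral J) {0..1}"
    and "(\<lambda>n. (cmod (c n))\<^sup>2) sums J"
proof -
  define G where "G t = (\<Sum>n. c n * cis (2 * pi * n * t))" for t :: real
  have "uniform_limit {0..1} (\<lambda>m t. \<Sum>n<m. c n * cis (2 * pi * n * t))
          (\<lambda>t. \<Sum>n. c n * cis (2 * pi * n * t)) sequentially"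
    by (rule Weierstrass_m_test[OF _ c]) (simp add: norm_mult)
  then have G: "continuous_on {0..1} G"
    unfolding G_def
    by (rule uniform_limit_theorem[rotated]) (auto intro!: always_eventually continuous_intros)
  have coeff: "((\<lambda>t. cis (2 * pi * k * t) * cnj (G t)) has_integral cnj (c k)) {0..1}" for k
  proof -
    obtain J where J: "((\<lambda>t. G t * cnj (cis (2 * pi * k * t))) has_integral J) {0..1}"
      "(\<lambda>n. c n * (if n = k then 1 else 0)) sums J"
      unfolding G_def
      by (rule has_integral_fourier_series_mult[OF c _ cis_orthonormal[of _ k]])
         (auto intro!: continuous_intros)
    have "(\<lambda>n. if n = k then c n else 0) sums J"
      using J(2) by (simp add: if_distrib cong: if_cong)
    then have "J = c k"
      using sums_single[of k c] sums_unique2 by blast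
    then show ?thesis using iffD2[OF has_integral_cnj J(1)] by (simp add: o_def mult.commute)
  qed
  \<comment> \<open>Now \<open>H\<close> is \<open>cnj (G t)\<close>, whose moments
    \<open>cnj (c k)\<close> were just found.\<close>
  obtain J where J: "((\<lambda>t. G t * cnj (G t)) has_integral J) {0..1}" "(\<lambda>n. c n * cnj (c n)) sums J"
    unfolding G_def
    by (rule has_integral_fourier_series_mult[OF c _ coeff[unfolded G_def]])
       (use G in \<open>auto intro!: continuous_intros simp: G_def[abs_def]\<close>)
  have sq: "Re (z * cnj z) = (cmod z)\<^sup>2" for z
    by (simp add: complex_mult_cnj cmod_power2)
  show thesis
    using has_integral_Re[OF J(1), unfolded sq G_def] sums_Re[OF J(2), unfolded sq] by (rule that)
qed

text \<open>Multiplication by a function bounded by 1 is a contraction of the Hardy space.\<close>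

lemma schur_multiplier_contraction:
  fixes p :: "nat \<Rightarrow> complex"
  assumes f: "f \<in> schur_class" and a: "disc_series f a"
    and p: "\<And>j. j > M \<Longrightarrow> p j = 0" and K: "finite K"
  shows "(\<Sum>k\<in>K. (cmod (\<Sum>i\<le>k. a i * p (k - i)))\<^sup>2) \<le> (\<Sum>j\<le>M. (cmod (p j))\<^sup>2)"
proof -
  define c where "c k = (\<Sum>i\<le>k. a i * p (k - i))" for k
  \<comment> \<open>Here \<open>c\<close> is the coefficient sequence of the product of
    \<open>f\<close> and the polynomial with coefficients \<open>p\<close>. Parseval is applied on
    circles of radius r < 1, where all series converge absolutely; r tends to 1 only at the
    end.\<close>
  have bound: "(\<Sum>k\<in>K. (cmod (c k))\<^sup>2 * (r\<^sup>2) ^ k) \<le> (\<Sum>j\<le>M. (cmod (p j))\<^sup>2)"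
    if r: "0 < r" "r < 1" for r :: real
  proof -
    \<comment> \<open>Convergence at a point farther out than r gives absolute convergence at
      r.\<close>
    have "complex_of_real ((1 + r) / 2) \<in> ball 0 1"
      using r by (simp del: of_real_add of_real_divide)
    then have "summable (\<lambda>n. a n * of_real ((1 + r) / 2) ^ n)"
      using a unfolding disc_series_def by (blast intro: sums_summable)
    then have sa: "summable (\<lambda>n. cmod (a n * of_real r ^ n))"
      by (rule powser_insidea) (use r in \<open>simp del: of_real_add of_real_divide\<close>)
    have sp: "(\<lambda>n. p n * w ^ n) sums (\<Sum>n\<le>M. p n * w ^ n)" for w
      by (rule sums_finite) (auto simp: p)
    have sp': "summable (\<lambda>n. cmod (p n * w ^ n))" for w
      by (rule summable_finite[of "{..M}"]) (auto simp: p)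
    define z where "z t = of_real r * cis (2 * pi * t)" for t
    have z: "cmod (z t) = r" for t using r by (simp add: z_def norm_mult)
    have zn: "z t ^ n = of_real r ^ n * cis (2 * pi * n * t)" for t n
      by (simp add: z_def power_mult_distrib Complex.DeMoivre algebra_simps)
    have G: "(\<Sum>n. (c n * of_real r ^ n) * cis (2 * pi * n * t)) = f (z t) * (\<Sum>n. p n * z t ^ n)"
      and sc: "summable (\<lambda>n. cmod (c n * of_real r ^ n))" for t
    proof -
      have "summable (\<lambda>n. cmod (a n * z t ^ n))" for t
        using sa r by (simp add: norm_mult norm_power z)
      note C = Cauchy_product_sums[OF this[of t] sp'[of "z t"]]
      have eq: "(\<Sum>i\<le>k. a i * z t ^ i * (p (k - i) * z t ^ (k - i))) = c k * z t ^ k" for t k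
        unfolding c_def sum_distrib_right
        by (rule sum.cong) (auto simp: power_add[symmetric])
      have "(\<Sum>k. a k * z t ^ k) = f (z t)"
        using a[unfolded disc_series_def] r by (auto intro!: sums_unique[symmetric] simp: z)
      with C eq show "(\<Sum>n. (c n * of_real r ^ n) * cis (2 * pi * n * t)) = f (z t) * (\<Sum>n. p n * z t ^ n)"
        by (simp add: zn sums_iff mult.assoc)
      \<comment> \<open>The point \<open>z 0\<close> represents the whole circle, since only moduli
        matter here.\<close>
      have *: "summable (\<lambda>k. \<Sum>i\<le>k. cmod (a i * z 0 ^ i) * cmod (p (k - i) * z 0 ^ (k - i)))"
        by (rule summable_Cauchy_product) (use sa sp'[of "z 0"] r in \<open>simp_all add: norm_mult norm_power z\<close>)
      show "summable (\<lambda>n. cmod (c n * of_real r ^ n))"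
      proof (rule summable_comparison_test'[OF *])
        fix n
        have "cmod (c n * z 0 ^ n) \<le> (\<Sum>i\<le>n. cmod (a i * z 0 ^ i) * cmod (p (n - i) * z 0 ^ (n - i)))"
          unfolding eq[symmetric] norm_mult[symmetric] by (rule norm_sum)
        then show "norm (cmod (c n * of_real r ^ n)) \<le> (\<Sum>i\<le>n. cmod (a i * z 0 ^ i) * cmod (p (n - i) * z 0 ^ (n - i)))"
          using r by (simp add: z norm_mult norm_power)
      qed
    qed
    obtain J where J: "((\<lambda>t. (cmod (\<Sum>n. (c n * of_real r ^ n) * cis (2 * pi * n * t)))\<^sup>2) has_integral J) {0..1}"
      "(\<lambda>n. (cmod (c n * of_real r ^ n))\<^sup>2) sums J"
      by (rule parseval_abs_summable[OF sc])
    obtain L where L: "((\<lambda>t. (cmod (\<Sum>n. (p n * of_real r ^ n) * cis (2 * pi * n * t)))\<^sup>2) has_integral L) {0..1}"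
      "(\<lambda>n. (cmod (p n * of_real r ^ n))\<^sup>2) sums L"
      by (rule parseval_abs_summable[OF sp'])
    have "J \<le> L"
    proof (rule has_integral_le[OF J(1) L(1)])
      fix t :: real
      have "z t \<in> ball 0 1" using r by (simp add: z)
      then have "f (z t) \<in> ball 0 1" using f unfolding schur_class_def by blast
      then have "cmod (f (z t)) * cmod (\<Sum>n. p n * z t ^ n) \<le> 1 * cmod (\<Sum>n. p n * z t ^ n)"
        by (intro mult_right_mono) auto
      moreover have "(\<Sum>n. (p n * of_real r ^ n) * cis (2 * pi * n * t)) = (\<Sum>n. p n * z t ^ n)"
        by (simp add: zn mult.assoc)
      ultimately show "(cmod (\<Sum>n. (c n * of_real r ^ n) * cis (2 * pi * n * t)))\<^sup>2
          \<le> (cmod (\<Sum>n. (p n * of_real r ^ n) * cis (2 * pi * n * t)))\<^sup>2"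
        by (simp add: G norm_mult power_mono)
    qed
    moreover have "(\<lambda>n. (cmod (p n * of_real r ^ n))\<^sup>2) sums (\<Sum>n\<le>M. (cmod (p n * of_real r ^ n))\<^sup>2)"
      by (rule sums_finite) (auto simp: p)
    then have "L = (\<Sum>n\<le>M. (cmod (p n * of_real r ^ n))\<^sup>2)"
      using L(2) sums_unique2 by blast
    moreover have "\<dots> \<le> (\<Sum>n\<le>M. (cmod (p n))\<^sup>2)"
    proof (rule sum_mono)
      show "(cmod (p n * of_real r ^ n))\<^sup>2 \<le> (cmod (p n))\<^sup>2" for n
        using r by (intro power_mono) (auto simp: norm_mult norm_power mult_left_le power_le_one)
    qed
    moreover have "(\<Sum>k\<in>K. (cmod (c k))\<^sup>2 * (r\<^sup>2) ^ k) \<le> J"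
    proof -
      have "(\<Sum>k\<in>K. (cmod (c k * of_real r ^ k))\<^sup>2) \<le> J"
        using sum_le_suminf[OF sums_summable[OF J(2)] K] sums_unique[OF J(2)] by simp
      then show ?thesis using r
        by (simp add: norm_mult norm_power power_mult_distrib power_mult[symmetric] mult.commute)
    qed
    ultimately show ?thesis by linarith
  qed
  \<comment> \<open>Since \<open>K\<close> is finite, the left side of the bound is continuous in r
    and the weights tend to 1.\<close>
  have "((\<lambda>r. \<Sum>k\<in>K. (cmod (c k))\<^sup>2 * (r\<^sup>2) ^ k) \<longlongrightarrow> (\<Sum>k\<in>K. (cmod (c k))\<^sup>2 * (1\<^sup>2) ^ k)) (at_left (1::real))"
    by (intro tendsto_intros)
  moreover have "eventually (\<lambda>r::real. 0 < r \<and> r < 1) (at_left 1)"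
    using eventually_at_left_real[of 0 1] by simp
  then have "eventually (\<lambda>r. (\<Sum>k\<in>K. (cmod (c k))\<^sup>2 * (r\<^sup>2) ^ k) \<le> (\<Sum>j\<le>M. (cmod (p j))\<^sup>2)) (at_left (1::real))"
    by (rule eventually_mono) (use bound in auto)
  ultimately show ?thesis
    using tendsto_upperbound[OF _ _ trivial_limit_at_left_real] by (fastforce simp: c_def)
qed

subsection \<open>Coefficient inequalities\<close>

text \<open>Both coefficient inequalities below, due to Carlson, test the contraction on a polynomial
  \<open>1 + y z\<^sup>n + \<lambda> q\<close> in which \<open>q\<close> is the reversed conjugate of an initial segment of the
  power series: the top coefficient of the product then contains \<open>\<lambda> \<Sum>\<bar>a\<^sub>k\<bar>\<^sup>2\<close>, and the
  unimodular number \<open>\<lambda>\<close> aligns it with the coefficient to be estimated.\<close>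

lemma unimodular_align:
  obtains l :: complex where "cmod l = 1" "w = of_real (cmod w) * l"
proof (cases "w = 0")
  case True
  then show thesis using that[of 1] by simp
next
  case False
  then have "cmod (sgn w) = 1" "w = of_real (cmod w) * sgn w"
    by (simp add: norm_sgn, simp add: sgn_eq)
  then show thesis by (rule that)
qed

lemma schur_coeff_odd:
  assumes f: "f \<in> schur_class" and a: "disc_series f a"
  shows "cmod (a (2 * n + 1)) + (\<Sum>k\<le>n. (cmod (a k))\<^sup>2) \<le> 1"
proof -
  define s where "s = (\<Sum>k\<le>n. (cmod (a k))\<^sup>2)"
  define Q where "Q = cmod (a (2 * n + 1)) + s"
  obtain l where l: "cmod l = 1" "a (2 * n + 1) = of_real (cmod (a (2 * n + 1))) * l"
    by (rule unimodular_align)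
  \<comment> \<open>The block in degrees n+1 to 2n+1 is the reversed conjugate of a_0, ..., a_n.
    Starting above degree n, it leaves the product coefficients up to degree n equal to those of
    \<open>f\<close>.\<close>
  define p where "p j = (if j = 0 then 1 else if n < j \<and> j \<le> 2 * n + 1 then l * cnj (a (2 * n + 1 - j)) else 0)" for j
  have low: "(\<Sum>i\<le>k. a i * p (k - i)) = a k" if "k \<le> n" for k
  proof -
    have "(\<Sum>i\<le>k. a i * p (k - i)) = (\<Sum>i\<le>k. if i = k then a k else 0)"
      by (rule sum.cong) (use that in \<open>auto simp: p_def\<close>)
    then show ?thesis by simp
  qed
  have top: "(\<Sum>i\<le>2 * n + 1. a i * p (2 * n + 1 - i)) = of_real Q * l"
  proof -
    have "(\<Sum>i\<le>2 * n + 1. a i * p (2 * n + 1 - i))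
        = (\<Sum>i\<le>2 * n + 1. (if i = 2 * n + 1 then a (2 * n + 1) else 0)
            + (if i \<in> {..n} then of_real ((cmod (a i))\<^sup>2) * l else 0))"
      by (rule sum.cong) (auto simp: p_def complex_mult_cnj cmod_power2 algebra_simps)
    also have "\<dots> = a (2 * n + 1) + (\<Sum>i\<in>{..2 * n + 1} \<inter> {..n}. of_real ((cmod (a i))\<^sup>2) * l)"
      unfolding sum.distrib by (subst sum.inter_restrict) (auto simp del: sum.atMost_Suc)
    also have "{..2 * n + 1} \<inter> {..n} = {..n}" by auto
    finally show ?thesis
      using l(2) by (simp add: Q_def s_def sum_distrib_right[symmetric] distrib_right)
  qed
  have norm_p: "(\<Sum>j\<le>2 * n + 1. (cmod (p j))\<^sup>2) = 1 + s"
  proof -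
    have "(\<Sum>j\<le>2 * n + 1. (cmod (p j))\<^sup>2) = (\<Sum>j\<le>2 * n + 1. (cmod (p (2 * n + 1 - j)))\<^sup>2)"
      using sum.atLeastAtMost_rev[of "\<lambda>j. (cmod (p j))\<^sup>2" 0 "2 * n + 1"] by (simp add: atLeast0AtMost)
    also have "\<dots> = (\<Sum>i\<le>2 * n + 1. (if i = 2 * n + 1 then 1 else 0)
            + (if i \<in> {..n} then (cmod (a i))\<^sup>2 else 0))"
      by (rule sum.cong) (auto simp: p_def norm_mult l(1))
    also have "\<dots> = 1 + (\<Sum>i\<in>{..2 * n + 1} \<inter> {..n}. (cmod (a i))\<^sup>2)"
      unfolding sum.distrib by (subst sum.inter_restrict) (auto simp del: sum.atMost_Suc)
    also have "{..2 * n + 1} \<inter> {..n} = {..n}" by auto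
    finally show ?thesis by (simp add: s_def)
  qed
  \<comment> \<open>Of the product only the degrees up to n and the top one are kept. The former
    contribute \<open>s\<close>, which cancels the \<open>s\<close> in the norm of \<open>p\<close>
    and leaves Q^2 \<le> 1.\<close>
  have "(\<Sum>k\<in>insert (2 * n + 1) {..n}. (cmod (\<Sum>i\<le>k. a i * p (k - i)))\<^sup>2) \<le> 1 + s"
    unfolding norm_p[symmetric] by (rule schur_multiplier_contraction[OF f a]) (auto simp: p_def)
  moreover have "(\<Sum>k\<le>n. (cmod (\<Sum>i\<le>k. a i * p (k - i)))\<^sup>2) = s"
    unfolding s_def by (rule sum.cong) (auto simp: low)
  ultimately have "Q\<^sup>2 \<le> 1"
    using top l(1) by (simp add: norm_mult del: sum.atMost_Suc)
  then have "Q \<le> 1"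
    using power2_le_imp_le[of Q 1] by simp
  then show ?thesis by (simp add: Q_def s_def)
qed

lemma schur_coeff_even:
  assumes f: "f \<in> schur_class" and a: "disc_series f a" and n: "n \<ge> 1"
  shows "cmod (a (2 * n)) + (\<Sum>k<n. (cmod (a k))\<^sup>2) + (cmod (a n))\<^sup>2 / (1 + cmod (a 0)) \<le> 1"
proof -
  define s where "s = (\<Sum>k<n. (cmod (a k))\<^sup>2)"
  define B where "B = cmod (a n)"
  define C where "C = cmod (a 0)"
  \<comment> \<open>The solution of t = B - C t: a middle coefficient \<open>y\<close> of this
    modulus keeps |a_n + a_0 y| at least t, which cancels the t^2 that \<open>y\<close> adds to the
    norm of \<open>p\<close>.\<close>
  define t where "t = B / (1 + C)"
  define Q where "Q = cmod (a (2 * n)) + s"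
  obtain l where l: "cmod l = 1" "a (2 * n) = of_real (cmod (a (2 * n))) * l"
    by (rule unimodular_align)
  obtain m where m: "cmod m = 1" "a n = of_real B * m"
    unfolding B_def by (rule unimodular_align)
  \<comment> \<open>The phase turns a_n y into the direction \<open>l\<close>, so that it adds B t
    to the top coefficient without cancellation.\<close>
  define y where "y = of_real t * l * cnj m"
  define p where "p j = (if j = 0 then 1 else if j = n then y else
    if n < j \<and> j \<le> 2 * n then l * cnj (a (2 * n - j)) else 0)" for j
  have BC: "B \<ge> 0" "C \<ge> 0" by (simp_all add: B_def C_def)
  then have t0: "t \<ge> 0" and tB: "t = B - C * t" by (simp_all add: t_def field_simps)
  have my: "a n * y = of_real (B * t) * l"
    using m(1) complex_norm_square[of m] by (simp add: m(2) y_def algebra_simps)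
  have ny: "cmod y = t" using t0 by (simp add: y_def norm_mult l(1) m(1))
  have low: "(\<Sum>i\<le>k. a i * p (k - i)) = a k" if "k < n" for k
  proof -
    have "(\<Sum>i\<le>k. a i * p (k - i)) = (\<Sum>i\<le>k. if i = k then a k else 0)"
      by (rule sum.cong) (use that in \<open>auto simp: p_def\<close>)
    then show ?thesis by simp
  qed
  have mid: "(\<Sum>i\<le>n. a i * p (n - i)) = a n + a 0 * y"
  proof -
    have "(\<Sum>i\<le>n. a i * p (n - i)) = (\<Sum>i\<le>n. (if i = n then a n else 0) + (if i = 0 then a 0 * y else 0))"
      by (rule sum.cong) (use n in \<open>auto simp: p_def\<close>)
    then show ?thesis by (simp add: sum.distrib)
  qed
  have top: "(\<Sum>i\<le>2 * n. a i * p (2 * n - i)) = of_real (Q + B * t) * l"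
  proof -
    have "(\<Sum>i\<le>2 * n. a i * p (2 * n - i))
        = (\<Sum>i\<le>2 * n. (if i = 2 * n then a (2 * n) else 0) + (if i = n then a n * y else 0)
            + (if i \<in> {..<n} then of_real ((cmod (a i))\<^sup>2) * l else 0))"
      by (rule sum.cong) (use n in \<open>auto simp: p_def complex_mult_cnj cmod_power2 algebra_simps\<close>)
    also have "\<dots> = a (2 * n) + a n * y + (\<Sum>i\<in>{..2 * n} \<inter> {..<n}. of_real ((cmod (a i))\<^sup>2) * l)"
      unfolding sum.distrib by (subst sum.inter_restrict) auto
    also have "{..2 * n} \<inter> {..<n} = {..<n}" by auto
    finally show ?thesis
      using l(2) by (simp add: my Q_def s_def sum_distrib_right[symmetric] distrib_right)
  qed
  have norm_p: "(\<Sum>j\<le>2 * n. (cmod (p j))\<^sup>2) = 1 + t\<^sup>2 + s"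
  proof -
    have "(\<Sum>j\<le>2 * n. (cmod (p j))\<^sup>2) = (\<Sum>j\<le>2 * n. (cmod (p (2 * n - j)))\<^sup>2)"
      using sum.atLeastAtMost_rev[of "\<lambda>j. (cmod (p j))\<^sup>2" 0 "2 * n"] by (simp add: atLeast0AtMost)
    also have "\<dots> = (\<Sum>i\<le>2 * n. (if i = 2 * n then 1 else 0) + (if i = n then t\<^sup>2 else 0)
            + (if i \<in> {..<n} then (cmod (a i))\<^sup>2 else 0))"
      by (rule sum.cong) (use n in \<open>auto simp: p_def norm_mult l(1) ny\<close>)
    also have "\<dots> = 1 + t\<^sup>2 + (\<Sum>i\<in>{..2 * n} \<inter> {..<n}. (cmod (a i))\<^sup>2)"
      unfolding sum.distrib by (subst sum.inter_restrict) auto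
    also have "{..2 * n} \<inter> {..<n} = {..<n}" by auto
    finally show ?thesis by (simp add: s_def)
  qed
  have "(\<Sum>k\<in>insert (2 * n) (insert n {..<n}). (cmod (\<Sum>i\<le>k. a i * p (k - i)))\<^sup>2) \<le> 1 + t\<^sup>2 + s"
    unfolding norm_p[symmetric] by (rule schur_multiplier_contraction[OF f a]) (auto simp: p_def)
  moreover have "(\<Sum>k<n. (cmod (\<Sum>i\<le>k. a i * p (k - i)))\<^sup>2) = s"
    unfolding s_def by (rule sum.cong) (auto simp: low)
  moreover have "cmod (of_real (Q + B * t) * l) = \<bar>Q + B * t\<bar>"
    unfolding norm_mult l(1) norm_of_real by simp
  ultimately have *: "(Q + B * t)\<^sup>2 + (cmod (a n + a 0 * y))\<^sup>2 \<le> 1 + t\<^sup>2"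
    using top mid n by simp
  have "t \<le> cmod (a n + a 0 * y)"
    using norm_triangle_ineq2[of "a n" "- (a 0 * y)"] tB by (simp add: norm_mult ny B_def C_def)
  then have "t\<^sup>2 \<le> (cmod (a n + a 0 * y))\<^sup>2"
    using t0 by (rule power_mono)
  with * have "Q + B * t \<le> 1"
    using power2_le_imp_le[of "Q + B * t" 1] by simp
  moreover have "B * t = B\<^sup>2 / (1 + C)" by (simp add: t_def power2_eq_square)
  ultimately show ?thesis by (simp add: Q_def s_def B_def C_def)
qed

lemma schur_coeff_le_1:
  assumes f: "f \<in> schur_class" and a: "disc_series f a"
  shows "cmod (a n) \<le> 1"
proof -
  \<comment> \<open>The contraction is applied to the constant polynomial 1, observing the single
    degree n.\<close>
  have "(cmod (\<Sum>i\<le>n. a i * (if n - i = 0 then 1 else 0)))\<^sup>2 \<le> 1"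
    using schur_multiplier_contraction[OF f a, of 0 "\<lambda>j. if j = 0 then 1 else 0" "{n}"] by simp
  moreover have "(\<Sum>i\<le>n. a i * (if n - i = 0 then 1 else 0)) = (\<Sum>i\<le>n. if i = n then a n else 0)"
    by (rule sum.cong) auto
  ultimately show ?thesis using power2_le_imp_le[of "cmod (a n)" 1] by simp
qed

text \<open>The weight with which \<open>\<bar>a\<^sub>j\<bar>\<^sup>2\<close> enters the estimate of \<open>\<bar>a\<^sub>n\<bar>\<close>.\<close>

definition carlson_weight :: "real \<Rightarrow> nat \<Rightarrow> nat \<Rightarrow> real" where
  "carlson_weight c n j = (if 2 * j < n then 1 else if 2 * j = n then 1 / (1 + c) else 0)"

text \<open>Both parities in one form, with the term of index 0 moved to the right. The weights
  vanish for 2 j > n, so the bound \<open>J\<close> can be chosen independently of n, which lets the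
  sums over n and j be exchanged later.\<close>

lemma schur_coeff_weighted:
  assumes f: "f \<in> schur_class" and a: "disc_series f a" and n: "n \<ge> 1"
  shows "cmod (a n) + (\<Sum>j = 1..J. (cmod (a j))\<^sup>2 * carlson_weight (cmod (a 0)) n j) \<le> 1 - (cmod (a 0))\<^sup>2"
proof -
  let ?w = "\<lambda>j. (cmod (a j))\<^sup>2 * carlson_weight (cmod (a 0)) n j"
  have nn: "?w j \<ge> 0" for j by (simp add: carlson_weight_def)
  have "(\<Sum>j = 1..J. ?w j) = (\<Sum>j\<in>{1..J} \<inter> {1..n div 2}. ?w j)"
    by (rule sum.mono_neutral_right) (auto simp: carlson_weight_def)
  also have "\<dots> \<le> (\<Sum>j = 1..n div 2. ?w j)"
    by (rule sum_mono2) (auto simp: nn)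
  finally have le: "(\<Sum>j = 1..J. ?w j) \<le> (\<Sum>j = 1..n div 2. ?w j)" .
  show ?thesis
  proof (cases "even n")
    case True
    then obtain k where k: "n = 2 * k" "k \<ge> 1" using n by auto
    then obtain k' where k': "k = Suc k'" by (cases k) auto
    have "(\<Sum>j = 1..n div 2. ?w j) = (\<Sum>j = 1..k'. ?w j) + ?w k"
      by (simp add: k k')
    also have "(\<Sum>j = 1..k'. ?w j) = (\<Sum>j = 1..k'. (cmod (a j))\<^sup>2)"
      by (rule sum.cong) (auto simp: carlson_weight_def k k')
    also have "?w k = (cmod (a k))\<^sup>2 / (1 + cmod (a 0))"
      by (simp add: carlson_weight_def k)
    also have "(\<Sum>j = 1..k'. (cmod (a j))\<^sup>2) = (\<Sum>j<k. (cmod (a j))\<^sup>2) - (cmod (a 0))\<^sup>2"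
      unfolding k' sum.lessThan_Suc_shift One_nat_def sum.atLeast1_atMost_eq by simp
    finally show ?thesis
      using schur_coeff_even[OF f a k(2)] le by (simp add: k(1))
  next
    case False
    then obtain k where k: "n = 2 * k + 1" by (auto elim: oddE)
    have "(\<Sum>j = 1..n div 2. ?w j) = (\<Sum>j = 1..k. (cmod (a j))\<^sup>2)"
      by (rule sum.cong) (auto simp: carlson_weight_def k)
    also have "(\<Sum>j = 1..k. (cmod (a j))\<^sup>2) = (\<Sum>j\<le>k. (cmod (a j))\<^sup>2) - (cmod (a 0))\<^sup>2"
      unfolding sum.atMost_shift One_nat_def sum.atLeast1_atMost_eq by simp
    finally show ?thesis
      using schur_coeff_odd[OF f a, of k] le by (simp add: k)
  qed
qed

section \<open>Summation of the coefficient inequalities over n \<ge> N\<close>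

lemma carlson_weight_sums:
  assumes r: "0 \<le> r" "r < (1::real)" and j: "1 \<le> j"
  shows "(\<lambda>n. carlson_weight c (n + N) j * r ^ (n + N)) sums
    (if j \<le> (N - 1) div 2 then r ^ N / (1 - r)
     else (1 / (1 + c) + r / (1 - r)) * r ^ (2 * j))"
proof (cases "j \<le> (N - 1) div 2")
  case True
  \<comment> \<open>Here 2 j < N, so every n \<ge> N carries weight 1.\<close>
  have "(\<lambda>n. r ^ n * r ^ N) sums (1 / (1 - r) * r ^ N)"
    by (intro sums_mult2 geometric_sums) (use r in auto)
  moreover have "carlson_weight c (n + N) j = 1" for n
    using True j by (auto simp: carlson_weight_def)
  ultimately show ?thesis using True by (simp add: power_add)
next
  case False
  then have N: "N \<le> 2 * j" by linarith
  let ?g = "\<lambda>n. carlson_weight c (n + N) j * r ^ (n + N)"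
  \<comment> \<open>Here the weights start at n = 2 j with 1 / (1 + c) and equal 1 from n = 2 j + 1
    on. The geometric tail is summed first, then the term n = 2 j is prepended, then the vanishing
    terms before it.\<close>
  have "(\<lambda>n. r ^ n * (r ^ (2 * j) * r)) sums (1 / (1 - r) * (r ^ (2 * j) * r))"
    by (intro sums_mult2 geometric_sums) (use r in auto)
  then have "(\<lambda>n. ?g (Suc n + (2 * j - N))) sums (1 / (1 - r) * (r ^ (2 * j) * r))"
    using N by (simp add: carlson_weight_def power_add mult.commute mult.left_commute)
  then have "(\<lambda>n. ?g (n + (2 * j - N))) sums (1 / (1 - r) * (r ^ (2 * j) * r) + ?g (0 + (2 * j - N)))"
    by (rule sums_Suc)
  moreover have "?g i = 0" if "i < 2 * j - N" for i
    using that by (auto simp: carlson_weight_def)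
  ultimately have "?g sums (1 / (1 - r) * (r ^ (2 * j) * r) + ?g (0 + (2 * j - N)))"
    using sums_zero_iff_shift[of "2 * j - N" ?g] by blast
  then show ?thesis using False N by (simp add: carlson_weight_def algebra_simps)
qed

lemma schur_coeff_power_summable:
  assumes f: "f \<in> schur_class" and a: "disc_series f a" and r: "0 \<le> r" "r < (1::real)"
  shows "summable (\<lambda>n. (cmod (a (n + k)))\<^sup>2 * r ^ (2 * (n + k)))"
proof (rule summable_comparison_test'[OF summable_geometric[of r]])
  show "norm r < 1" using r by simp
  show "norm ((cmod (a (n + k)))\<^sup>2 * r ^ (2 * (n + k))) \<le> r ^ n" for n
  proof -
    have "(cmod (a (n + k)))\<^sup>2 * r ^ (2 * (n + k)) \<le> 1 * r ^ n"
      by (intro mult_mono power_le_one power_decreasing schur_coeff_le_1[OF f a]) (use r in auto)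
    then show ?thesis using r by simp
  qed
qed

text \<open>Only the indices j \<le> t + J enter at a time, so exchanging the sums over n and j is
  finite additivity of convergent series. The infinite square sum then follows because its partial
  sums are bounded uniformly in J.\<close>

lemma refined_bohr_terms_le:
  assumes f: "f \<in> schur_class" and a: "disc_series f a" and N: "N \<ge> 1" and r: "0 \<le> r" "r < 1"
  shows "refined_bohr_terms N a r \<le> (1 - (cmod (a 0))\<^sup>2) * r ^ N / (1 - r)"
proof -
  define t where "t = (N - 1) div 2"
  define q where "q = 1 / (1 + cmod (a 0)) + r / (1 - r)"
  define S where "S = (\<Sum>n. cmod (a (n + N)) * r ^ (n + N))"
  define T where "T = (\<Sum>j = 1..t. (cmod (a j))\<^sup>2 * (r ^ N / (1 - r)))"
  have q: "q > 0" unfolding q_def using r by (intro add_pos_nonneg) (auto intro: add_pos_nonneg)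
  have geo: "(\<lambda>n. r ^ (n + N)) sums (r ^ N / (1 - r))"
    using sums_mult2[OF geometric_sums[of r], of "r ^ N"] r by (simp add: power_add)
  have sS: "(\<lambda>n. cmod (a (n + N)) * r ^ (n + N)) sums S"
    unfolding S_def
  proof (rule summable_sums, rule summable_comparison_test'[OF sums_summable[OF geo]])
    show "norm (cmod (a (n + N)) * r ^ (n + N)) \<le> r ^ (n + N)" for n
      using schur_coeff_le_1[OF f a] r by (simp add: mult_left_le_one_le)
  qed
  have partial: "S + T + (\<Sum>j<J. (cmod (a (j + (t + 1))))\<^sup>2 * (q * r ^ (2 * (j + (t + 1)))))
      \<le> (1 - (cmod (a 0))\<^sup>2) * (r ^ N / (1 - r))" for J
  proof -
    let ?v = "\<lambda>j. if j \<le> t then r ^ N / (1 - r) else q * r ^ (2 * j)"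
    have lhs: "(\<lambda>n. cmod (a (n + N)) * r ^ (n + N)
        + (\<Sum>j = 1..t + J. (cmod (a j))\<^sup>2 * (carlson_weight (cmod (a 0)) (n + N) j * r ^ (n + N))))
      sums (S + (\<Sum>j = 1..t + J. (cmod (a j))\<^sup>2 * ?v j))"
      unfolding t_def q_def
      by (intro sums_add sS sums_sum sums_mult carlson_weight_sums r) auto
    have rhs: "(\<lambda>n. (1 - (cmod (a 0))\<^sup>2) * r ^ (n + N)) sums ((1 - (cmod (a 0))\<^sup>2) * (r ^ N / (1 - r)))"
      by (rule sums_mult[OF geo])
    have le: "cmod (a (n + N)) * r ^ (n + N)
        + (\<Sum>j = 1..t + J. (cmod (a j))\<^sup>2 * (carlson_weight (cmod (a 0)) (n + N) j * r ^ (n + N)))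
        \<le> (1 - (cmod (a 0))\<^sup>2) * r ^ (n + N)" for n
      using mult_right_mono[OF schur_coeff_weighted[OF f a, of "n + N" "t + J"], of "r ^ (n + N)"] N r
      by (simp add: distrib_right sum_distrib_right mult.assoc)
    have "S + (\<Sum>j = 1..t + J. (cmod (a j))\<^sup>2 * ?v j) \<le> (1 - (cmod (a 0))\<^sup>2) * (r ^ N / (1 - r))"
      using le lhs rhs by (rule sums_le)
    moreover have "(\<Sum>j = 1..t + J. (cmod (a j))\<^sup>2 * ?v j) = T + (\<Sum>j<J. (cmod (a (j + (t + 1))))\<^sup>2 * (q * r ^ (2 * (j + (t + 1)))))"
    proof (induction J)
      case 0
      show ?case by (auto simp: T_def intro!: sum.cong)
    next
      case (Suc J)
      then show ?case by (simp add: ac_simps)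
    qed
    ultimately show ?thesis by simp
  qed
  note sr = schur_coeff_power_summable[OF f a r, of "t + 1"]
  have "q * (\<Sum>n. (cmod (a (n + (t + 1))))\<^sup>2 * r ^ (2 * (n + (t + 1))))
      = (\<Sum>n. q * ((cmod (a (n + (t + 1))))\<^sup>2 * r ^ (2 * (n + (t + 1)))))"
    by (rule suminf_mult[OF sr, symmetric])
  also have "\<dots> \<le> (1 - (cmod (a 0))\<^sup>2) * (r ^ N / (1 - r)) - S - T"
    by (rule suminf_le_const[OF summable_mult[OF sr]]) (use partial in \<open>simp add: algebra_simps\<close>)
  finally have "S + T + q * (\<Sum>n. (cmod (a (n + (t + 1))))\<^sup>2 * r ^ (2 * (n + (t + 1))))
      \<le> (1 - (cmod (a 0))\<^sup>2) * (r ^ N / (1 - r))" by simp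
  \<comment> \<open>For t = 0 the sum \<open>T\<close> is empty; for t > 0 the sign is 1.\<close>
  moreover have "sgn (real t) * T = T" by (cases t) (auto simp: T_def)
  ultimately show ?thesis
    unfolding refined_bohr_terms_def Let_def t_def[symmetric] q_def[symmetric] S_def[symmetric] T_def[symmetric]
    by (simp only: times_divide_eq_right)
qed

subsection \<open>Schwarz-Pick bound and the radius equations\<close>

text \<open>The Schwarz lemma is applied to \<open>f\<close> followed by the disc automorphism
  sending f(0) to 0. The identity |1 - cnj a b|^2 - |b - a|^2 = (1 - |a|^2) (1 - |b|^2) then
  replaces the complex values by their moduli.\<close>

lemma schwarz_pick_origin:
  assumes f: "f \<in> schur_class" and z: "cmod z < 1"
  shows "cmod (f z) \<le> (cmod z + cmod (f 0)) / (1 + cmod (f 0) * cmod z)"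
proof -
  have hol: "f holomorphic_on ball 0 1"
    using f analytic_imp_holomorphic unfolding schur_class_def by blast
  have lt1: "cmod (f w) < 1" if "cmod w < 1" for w
  proof -
    have "f w \<in> ball 0 1" using f that unfolding schur_class_def by fastforce
    then show ?thesis by simp
  qed
  define r A X where "r = cmod z" and "A = cmod (f 0)" and "X = cmod (f z)"
  define D where "D = 1 - cnj (f 0) * f z"
  have rAX: "0 \<le> r" "r < 1" "0 \<le> A" "A < 1" "0 \<le> X" "X < 1"
    using z lt1 by (auto simp: r_def A_def X_def)
  define g where "g = Moebius_function 0 (f 0) \<circ> f"
  have "g holomorphic_on ball 0 1"
    unfolding g_def using lt1
    by (intro holomorphic_on_compose_gen[OF hol Moebius_function_holomorphic]) auto
  moreover have "g 0 = 0" by (simp add: g_def Moebius_function_eq_zero)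
  moreover have "cmod (g w) < 1" if "cmod w < 1" for w
    using that lt1 by (simp add: g_def Moebius_function_norm_lt_1)
  ultimately have "cmod (g z) \<le> r"
    using z unfolding r_def by (rule Schwarz_Lemma(1))
  moreover have DX: "1 - A * X \<le> cmod D"
    using norm_triangle_ineq2[of 1 "cnj (f 0) * f z"] by (simp add: D_def A_def X_def norm_mult)
  moreover have AX: "A * X < 1"
    using rAX mult_strict_mono[of A 1 X 1] by (cases "X = 0") auto
  moreover have "D \<noteq> 0" using DX AX by auto
  ultimately have "cmod (f z - f 0) \<le> r * cmod D"
    by (simp add: g_def Moebius_function_simple D_def[symmetric] norm_divide pos_divide_le_eq)
  then have "(cmod (f z - f 0))\<^sup>2 \<le> (r * cmod D)\<^sup>2"
    by (rule power_mono) simp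
  moreover have "(cmod D)\<^sup>2 - (cmod (f z - f 0))\<^sup>2 = (1 - A\<^sup>2) * (1 - X\<^sup>2)"
    unfolding D_def A_def X_def cmod_power2 by (simp add: power2_eq_square algebra_simps)
  ultimately have "(1 - r\<^sup>2) * (cmod D)\<^sup>2 \<le> (1 - A\<^sup>2) * (1 - X\<^sup>2)"
    by (simp add: algebra_simps power_mult_distrib)
  \<comment> \<open>With \<open>1 - A * X\<close> in place of |D|, the same identity for the real
    numbers A and X turns the estimate back into one for (X - A)^2.\<close>
  moreover have "(1 - r\<^sup>2) * (1 - A * X)\<^sup>2 \<le> (1 - r\<^sup>2) * (cmod D)\<^sup>2"
    using DX AX rAX by (intro mult_left_mono power_mono) (auto simp: power_le_one)
  ultimately have "(X - A)\<^sup>2 \<le> (r * (1 - A * X))\<^sup>2"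
    by (simp add: power2_eq_square algebra_simps)
  then have "X - A \<le> r * (1 - A * X)"
    by (rule power2_le_imp_le) (use rAX AX in auto)
  then have "X * (1 + A * r) \<le> r + A" by (simp add: algebra_simps)
  moreover have "0 < 1 + A * r" using rAX by (simp add: add_pos_nonneg)
  ultimately show ?thesis
    unfolding r_def[symmetric] A_def[symmetric] X_def[symmetric] by (simp add: pos_le_divide_eq)
qed

text \<open>The difference of the two sides increases strictly on [0, 1] from a negative to a
  positive value. The factor \<open>k\<close> is 2 for the first radius and 1 for the
  second.\<close>

lemma bohr_equation_root:
  fixes k :: real
  assumes k: "k \<ge> 1" and N: "N \<ge> 1"
  obtains R where "0 < R" "R < 1" "\<And>r. r > 0 \<and> k * (1 + r) * r ^ N - (1 - r)\<^sup>2 = 0 \<longleftrightarrow> r = R"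
    "\<And>r. 0 \<le> r \<Longrightarrow> r \<le> R \<Longrightarrow> k * (1 + r) * r ^ N \<le> (1 - r)\<^sup>2"
    "\<And>r. R < r \<Longrightarrow> r < 1 \<Longrightarrow> (1 - r)\<^sup>2 < k * (1 + r) * r ^ N"
proof -
  define h where "h r = k * (1 + r) * r ^ N - (1 - r)\<^sup>2" for r
  have mono: "h r < h s" if "0 \<le> r" "r < s" "s \<le> 1" for r s
  proof -
    have "k * (1 + r) * r ^ N \<le> k * (1 + s) * s ^ N"
      using that k by (intro mult_mono power_mono) auto
    moreover have "(1 - s)\<^sup>2 < (1 - r)\<^sup>2"
      using that by (intro power_strict_mono) auto
    ultimately show ?thesis by (simp add: h_def)
  qed
  \<comment> \<open>This excludes roots from 1 onwards; uniqueness is claimed among all positive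
    reals.\<close>
  have big: "h r > 0" if "r \<ge> 1" for r
  proof -
    have "1 * (1 + r) * r ^ 1 \<le> k * (1 + r) * r ^ N"
      using that k N by (intro mult_mono power_increasing) auto
    moreover have "(1 - r)\<^sup>2 < (1 + r) * r"
      using that by (simp add: power2_eq_square algebra_simps)
    ultimately show ?thesis by (simp add: h_def)
  qed
  have h0: "h 0 < 0" using N by (cases N) (auto simp: h_def)
  have "\<exists>R\<ge>0. R \<le> 1 \<and> h R = 0"
    by (rule IVT') (use h0 big[of 1] in \<open>auto simp: h_def intro!: continuous_intros\<close>)
  then obtain R where R: "0 \<le> R" "R \<le> 1" "h R = 0" by blast
  have "R \<noteq> 0" "R \<noteq> 1" using R(3) h0 big[of 1] by auto
  with R have R01: "0 < R" "R < 1" by auto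
  have le: "h r \<le> 0" if "0 \<le> r" "r \<le> R" for r
    using mono[of r R] that R by (cases "r = R") auto
  have gt: "h r > 0" if "R < r" for r
    using mono[of R r] big[of r] that R by (cases "r \<ge> 1") auto
  have lt: "h r < 0" if "0 \<le> r" "r < R" for r
    using mono[of r R] that R by auto
  have "r > 0 \<and> h r = 0 \<longleftrightarrow> r = R" for r
    using R01 R(3) lt[of r] gt[of r] by (cases r R rule: linorder_cases) auto
  then show thesis
    using R01 le gt by (intro that[of R]) (auto simp: h_def)
qed

text \<open>\<open>P\<close> stands for r^N. Since 1 - (r + A) / (1 + A r) = (1 - A) (1 - r) / (1 +
  A r), cancelling 1 - A leaves (1 + A) (1 + A r) P \<le> (1 - r)^2, whose left side is largest at A
  = 1.\<close>

lemma bohr_estimate_linear: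
  fixes A r P :: real
  assumes A: "0 \<le> A" "A < 1" and r: "0 \<le> r" "r < 1" and P: "0 \<le> P" "2 * (1 + r) * P \<le> (1 - r)\<^sup>2"
  shows "(r + A) / (1 + A * r) + (1 - A\<^sup>2) * P / (1 - r) \<le> 1"
proof -
  have pos: "0 < 1 + A * r" using A r by (simp add: add_pos_nonneg)
  have "(1 + A) * (1 + A * r) * P \<le> 2 * (1 + r) * P"
    using A r P by (intro mult_right_mono mult_mono) (auto simp: mult_left_le_one_le)
  with P have "(1 + A) * (1 + A * r) * P \<le> (1 - r)\<^sup>2" by linarith
  from mult_left_mono[OF this, of "1 - A"] A
  have "(1 - A\<^sup>2) * P * (1 + A * r) \<le> (1 - A) * (1 - r) * (1 - r)"
    by (simp add: power2_eq_square algebra_simps)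
  then have "(1 - A\<^sup>2) * P / (1 - r) \<le> (1 - A) * (1 - r) / (1 + A * r)"
    using pos r by (simp add: divide_simps mult.commute mult.left_commute)
  also have "\<dots> = 1 - (r + A) / (1 + A * r)"
    using pos by (simp add: field_simps)
  finally show ?thesis by simp
qed

text \<open>Squaring makes the gap (1 - A^2) (1 - r^2) / (1 + A r)^2, so the whole factor 1 - A^2
  cancels and the 2 of the linear case disappears. The worst case is again A = 1.\<close>

lemma bohr_estimate_square:
  fixes A r P :: real
  assumes A: "0 \<le> A" "A < 1" and r: "0 \<le> r" "r < 1" and P: "0 \<le> P" "(1 + r) * P \<le> (1 - r)\<^sup>2"
  shows "((r + A) / (1 + A * r))\<^sup>2 + (1 - A\<^sup>2) * P / (1 - r) \<le> 1"
proof -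
  have pos: "0 < 1 + A * r" using A r by (simp add: add_pos_nonneg)
  have "(1 + A * r)\<^sup>2 * P \<le> (1 + r)\<^sup>2 * P"
    using A r P by (intro mult_right_mono power_mono) (auto simp: mult_left_le_one_le)
  also have "\<dots> = (1 + r) * ((1 + r) * P)" by (simp add: power2_eq_square)
  also have "\<dots> \<le> (1 + r) * (1 - r)\<^sup>2" using P r by (intro mult_left_mono) auto
  finally have "(1 - A\<^sup>2) * ((1 + A * r)\<^sup>2 * P) \<le> (1 - A\<^sup>2) * ((1 + r) * (1 - r)\<^sup>2)"
    using A by (intro mult_left_mono) (auto simp: power_le_one)
  then have "(1 - A\<^sup>2) * P * (1 + A * r)\<^sup>2 \<le> (1 - A\<^sup>2) * (1 - r\<^sup>2) * (1 - r)"
    by (simp add: power2_eq_square algebra_simps)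
  then have "(1 - A\<^sup>2) * P / (1 - r) \<le> (1 - A\<^sup>2) * (1 - r\<^sup>2) / (1 + A * r)\<^sup>2"
    using pos r by (simp add: pos_divide_le_eq pos_le_divide_eq mult.commute mult.left_commute)
  also have "\<dots> = 1 - ((r + A) / (1 + A * r))\<^sup>2"
    using pos by (simp add: power_divide field_simps) (simp add: power2_eq_square algebra_simps)
  finally show ?thesis by simp
qed

subsection \<open>Extremal functions\<close>

text \<open>For 0 < c < 1 a disc automorphism sending 0 to c; it attains equality in
  \<open>schwarz_pick_origin\<close> at positive real points of the disc.\<close>

definition bohr_extremal :: "real \<Rightarrow> complex \<Rightarrow> complex" where
  "bohr_extremal c z = (z + c) / (1 + c * z)"

definition bohr_extremal_coeff :: "real \<Rightarrow> nat \<Rightarrow> complex" where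
  "bohr_extremal_coeff c n = (if n = 0 then c else (1 - c\<^sup>2) * (- c) ^ (n - 1))"

lemma bohr_extremal_schur_class:
  assumes c: "0 < c" "c < 1"
  shows "bohr_extremal c \<in> schur_class"
proof -
  have eq: "bohr_extremal c = Moebius_function 0 (- of_real c)"
    by (auto simp: bohr_extremal_def Moebius_function_simple)
  show ?thesis
    unfolding schur_class_def eq
    using c by (auto simp: analytic_on_open intro!: Moebius_function_holomorphic Moebius_function_norm_lt_1)
qed

lemma bohr_extremal_series:
  assumes c: "0 < c" "c < 1"
  shows "disc_series (bohr_extremal c) (bohr_extremal_coeff c)"
  unfolding disc_series_def
proof
  fix z :: complex
  assume "z \<in> ball 0 1"
  then have cz: "cmod (- of_real c * z) < 1"
    using c mult_strict_mono'[of c 1 "cmod z" 1] by (simp add: norm_mult)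
  then have nz: "1 + of_real c * z \<noteq> 0"
    by (metis add_eq_0_iff2 mult_minus_left norm_one less_irrefl minus_minus)
  \<comment> \<open>The function is c + (1 - c^2) z / (1 + c z), and the fraction is expanded as a
    geometric series.\<close>
  have "(\<lambda>n. (1 - of_real c ^ 2) * z * (- of_real c * z) ^ n) sums
          ((1 - of_real c ^ 2) * z * (1 / (1 - (- of_real c * z))))"
    by (intro sums_mult geometric_sums cz)
  then have "(\<lambda>n. bohr_extremal_coeff c (Suc n) * z ^ Suc n) sums
          ((1 - of_real c ^ 2) * z * (1 / (1 - (- of_real c * z))))"
    by (simp only: bohr_extremal_coeff_def power_mult_distrib) (simp add: mult_ac)
  then have "(\<lambda>n. bohr_extremal_coeff c n * z ^ n) sums
          ((1 - of_real c ^ 2) * z * (1 / (1 - (- of_real c * z))) + bohr_extremal_coeff c 0 * z ^ 0)"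
    by (rule sums_Suc)
  moreover have "(1 - of_real c ^ 2) * z * (1 / (1 - (- of_real c * z))) + bohr_extremal_coeff c 0 * z ^ 0
      = bohr_extremal c z"
    using nz by (simp add: bohr_extremal_coeff_def bohr_extremal_def field_simps power2_eq_square)
  ultimately show "(\<lambda>n. bohr_extremal_coeff c n * z ^ n) sums bohr_extremal c z" by simp
qed

text \<open>The left side is the sum of the |a_n| r^n alone. The discarded square terms are
  nonnegative and carry the factor (1 - c^2)^2, so dropping them costs nothing to first order as c
  tends to 1.\<close>

lemma refined_bohr_terms_extremal_ge:
  assumes c: "0 < c" "c < 1" and r: "0 \<le> r" "r < 1" and N: "N \<ge> 1"
  shows "(1 - c\<^sup>2) * (c ^ (N - 1) * r ^ N) / (1 - c * r) \<le> refined_bohr_terms N (bohr_extremal_coeff c) r"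
proof -
  let ?a = "bohr_extremal_coeff c"
  note summable = schur_coeff_power_summable[OF bohr_extremal_schur_class bohr_extremal_series, OF c c r]
  define t where "t = (N - 1) div 2"
  have c2: "0 \<le> 1 - c\<^sup>2" using c by (simp add: power_le_one)
  have cr: "c * r < 1" using mult_strict_mono'[of c 1 r 1] c r by simp
  have norm_a: "cmod (?a (n + N)) * r ^ (n + N) = (1 - c\<^sup>2) * (c ^ (N - 1) * r ^ N) * (c * r) ^ n" for n
  proof -
    have "?a (n + N) = of_real ((1 - c\<^sup>2) * (- c) ^ (n + (N - 1)))"
      using N by (simp add: bohr_extremal_coeff_def)
    then have "cmod (?a (n + N)) = \<bar>(1 - c\<^sup>2) * (- c) ^ (n + (N - 1))\<bar>"
      by (simp only: norm_of_real)
    also have "\<dots> = (1 - c\<^sup>2) * c ^ (n + (N - 1))"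
      using c c2 by (simp add: abs_mult power_abs)
    finally show ?thesis by (simp add: power_add power_mult_distrib)
  qed
  have "(\<lambda>n. cmod (?a (n + N)) * r ^ (n + N)) sums ((1 - c\<^sup>2) * (c ^ (N - 1) * r ^ N) * (1 / (1 - c * r)))"
    unfolding norm_a by (intro sums_mult geometric_sums) (use c r cr in auto)
  then have "(\<Sum>n. cmod (?a (n + N)) * r ^ (n + N)) = (1 - c\<^sup>2) * (c ^ (N - 1) * r ^ N) / (1 - c * r)"
    by (simp add: sums_iff)
  moreover have "0 \<le> sgn (real t) * (\<Sum>n = 1..t. (cmod (?a n))\<^sup>2 * (r ^ N / (1 - r)))"
    using r by (intro mult_nonneg_nonneg sum_nonneg) auto
  moreover have "0 \<le> (1 / (1 + cmod (?a 0)) + r / (1 - r)) * 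
      (\<Sum>n. (cmod (?a (n + (t + 1))))\<^sup>2 * r ^ (2 * (n + (t + 1))))"
    using r by (intro mult_nonneg_nonneg suminf_nonneg summable) auto
  ultimately show ?thesis
    unfolding refined_bohr_terms_def Let_def t_def[symmetric] by linarith
qed

text \<open>For c = 1 the extremal function degenerates to the constant 1, which leaves the class. A
  strict inequality there is therefore carried over to some c < 1.\<close>

lemma pos_left_of_1:
  fixes \<phi> :: "real \<Rightarrow> real"
  assumes "isCont \<phi> 1" "0 < \<phi> 1"
  obtains c where "0 < c" "c < 1" "0 < \<phi> c"
proof -
  have "(\<phi> \<longlongrightarrow> \<phi> 1) (at_left 1)"
    using assms(1) isCont_def filterlim_at_split by blast
  then have "\<forall>\<^sub>F c in at_left 1. 0 < \<phi> c"
    using assms(2) by (rule order_tendstoD)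
  moreover have "\<forall>\<^sub>F c in at_left (1::real). 0 < c \<and> c < 1"
    using eventually_at_left_real[of 0 1] by simp
  ultimately have "\<forall>\<^sub>F c in at_left 1. 0 < \<phi> c \<and> 0 < c \<and> c < 1"
    by (rule eventually_conj)
  then show thesis
    using that eventually_happens'[OF trivial_limit_at_left_real] by blast
qed

lemma bohr_extremal_of_real:
  assumes "0 < c" "0 \<le> r"
  shows "cmod (bohr_extremal c (of_real r)) = (r + c) / (1 + c * r)"
proof -
  have "bohr_extremal c (of_real r) = of_real ((r + c) / (1 + c * r))"
    by (simp add: bohr_extremal_def)
  then show ?thesis using assms by (simp only: norm_of_real) simp
qed

section \<open>Sharpness of the two radii\<close>

lemma bohr_linear_sharp:
  assumes r: "0 < r" "r < 1" and N: "N \<ge> 1" and h: "(1 - r)\<^sup>2 < 2 * (1 + r) * r ^ N"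
  obtains f a where "f \<in> schur_class" "disc_series f a"
    "1 < cmod (f (of_real r)) + refined_bohr_terms N a r"
proof -
  \<comment> \<open>The excess over 1 with denominators cleared and the common factor 1 - c removed;
    at c = 1 it equals 2 (1 + r) r^N - (1 - r)^2.\<close>
  define \<phi> where "\<phi> c = (1 + c) * (1 + c * r) * (c ^ (N - 1) * r ^ N) - (1 - r) * (1 - c * r)" for c
  have "isCont \<phi> 1" unfolding \<phi>_def by (intro continuous_intros)
  moreover have "0 < \<phi> 1" using h by (simp add: \<phi>_def power2_eq_square algebra_simps)
  ultimately obtain c where c: "0 < c" "c < 1" "0 < \<phi> c" by (rule pos_left_of_1)
  have pos: "0 < 1 + c * r" "0 < 1 - c * r"
    using c r mult_strict_mono'[of c 1 r 1] by (simp_all add: add_pos_pos)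
  have "(1 - c) * ((1 - r) * (1 - c * r)) < (1 - c) * ((1 + c) * (1 + c * r) * (c ^ (N - 1) * r ^ N))"
    using c by (intro mult_strict_left_mono) (auto simp: \<phi>_def)
  then have "(1 - c) * (1 - r) * (1 - c * r) < (1 - c\<^sup>2) * (c ^ (N - 1) * r ^ N) * (1 + c * r)"
    by (simp add: power2_eq_square algebra_simps)
  then have "(1 - c) * (1 - r) / (1 + c * r) < (1 - c\<^sup>2) * (c ^ (N - 1) * r ^ N) / (1 - c * r)"
    using pos by (simp add: pos_less_divide_eq pos_divide_less_eq mult.commute mult.left_commute)
  moreover have "(1 - c) * (1 - r) / (1 + c * r) = 1 - (r + c) / (1 + c * r)"
    using pos by (simp add: field_simps)
  ultimately have "1 < cmod (bohr_extremal c (of_real r)) + refined_bohr_terms N (bohr_extremal_coeff c) r"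
    using refined_bohr_terms_extremal_ge[OF c(1,2) _ r(2) N] r
    by (simp add: bohr_extremal_of_real[OF c(1)])
  then show thesis
    by (rule that[OF bohr_extremal_schur_class[OF c(1,2)] bohr_extremal_series[OF c(1,2)]])
qed

lemma bohr_square_sharp:
  assumes r: "0 < r" "r < 1" and N: "N \<ge> 1" and h: "(1 - r)\<^sup>2 < (1 + r) * r ^ N"
  obtains f a where "f \<in> schur_class" "disc_series f a"
    "1 < (cmod (f (of_real r)))\<^sup>2 + refined_bohr_terms N a r"
proof -
  \<comment> \<open>Here the common factor removed is 1 - c^2; at c = 1 the value is 1 + r times (1
    + r) r^N - (1 - r)^2.\<close>
  define \<phi> where "\<phi> c = (1 + c * r)\<^sup>2 * (c ^ (N - 1) * r ^ N) - (1 - r\<^sup>2) * (1 - c * r)" for c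
  have "isCont \<phi> 1" unfolding \<phi>_def by (intro continuous_intros)
  moreover have "0 < \<phi> 1"
  proof -
    have "(1 + r) * (1 - r)\<^sup>2 < (1 + r) * ((1 + r) * r ^ N)"
      using h r by (intro mult_strict_left_mono) auto
    then show ?thesis by (simp add: \<phi>_def power2_eq_square algebra_simps)
  qed
  ultimately obtain c where c: "0 < c" "c < 1" "0 < \<phi> c" by (rule pos_left_of_1)
  have pos: "0 < 1 + c * r" "0 < 1 - c * r"
    using c r mult_strict_mono'[of c 1 r 1] by (simp_all add: add_pos_pos)
  have "(1 - c\<^sup>2) * ((1 - r\<^sup>2) * (1 - c * r)) < (1 - c\<^sup>2) * ((1 + c * r)\<^sup>2 * (c ^ (N - 1) * r ^ N))"
    using c by (intro mult_strict_left_mono) (auto simp: \<phi>_def power_less_one_iff)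
  then have "(1 - c\<^sup>2) * (1 - r\<^sup>2) * (1 - c * r) < (1 - c\<^sup>2) * (c ^ (N - 1) * r ^ N) * (1 + c * r)\<^sup>2"
    by (simp only: mult_ac)
  then have "(1 - c\<^sup>2) * (1 - r\<^sup>2) / (1 + c * r)\<^sup>2 < (1 - c\<^sup>2) * (c ^ (N - 1) * r ^ N) / (1 - c * r)"
    using pos by (simp add: pos_less_divide_eq pos_divide_less_eq mult.commute mult.left_commute)
  moreover have "(1 - c\<^sup>2) * (1 - r\<^sup>2) / (1 + c * r)\<^sup>2 = 1 - ((r + c) / (1 + c * r))\<^sup>2"
    using pos by (simp add: power_divide field_simps) (simp add: power2_eq_square algebra_simps)
  ultimately have "1 < (cmod (bohr_extremal c (of_real r)))\<^sup>2 + refined_bohr_terms N (bohr_extremal_coeff c) r"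
    using refined_bohr_terms_extremal_ge[OF c(1,2) _ r(2) N] r
    by (simp add: bohr_extremal_of_real[OF c(1)])
  then show thesis
    by (rule that[OF bohr_extremal_schur_class[OF c(1,2)] bohr_extremal_series[OF c(1,2)]])
qed

theorem theorem1:
  fixes N :: nat
  assumes "N \<ge> 1"
  shows
    "(\<exists>!r::real. r > 0 \<and> 2 * (1 + r) * r ^ N - (1 - r)\<^sup>2 = 0)
   \<and> (\<exists>!r::real. r > 0 \<and> (1 + r) * r ^ N - (1 - r)\<^sup>2 = 0)
   \<and> (\<forall>f a z. f \<in> schur_class \<longrightarrow> disc_series f a \<longrightarrow> cmod z \<le> radius_R N \<longrightarrow>
        cmod (f z) + refined_bohr_terms N a (cmod z) \<le> 1)
   \<and> (\<forall>\<rho> > radius_R N. \<exists>f a z. f \<in> schur_class \<and> disc_series f a \<and>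
        cmod z < 1 \<and> cmod z \<le> \<rho> \<and>
        \<not> cmod (f z) + refined_bohr_terms N a (cmod z) \<le> 1)
   \<and> (\<forall>f a z. f \<in> schur_class \<longrightarrow> disc_series f a \<longrightarrow> cmod z \<le> radius_R' N \<longrightarrow>
        (cmod (f z))\<^sup>2 + refined_bohr_terms N a (cmod z) \<le> 1)
   \<and> (\<forall>\<rho> > radius_R' N. \<exists>f a z. f \<in> schur_class \<and> disc_series f a \<and>
        cmod z < 1 \<and> cmod z \<le> \<rho> \<and>
        \<not> (cmod (f z))\<^sup>2 + refined_bohr_terms N a (cmod z) \<le> 1)"
proof -
  obtain R :: real where R: "0 < R" "R < 1" "\<And>r. r > 0 \<and> 2 * (1 + r) * r ^ N - (1 - r)\<^sup>2 = 0 \<longleftrightarrow> r = R"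
    "\<And>r. 0 \<le> r \<Longrightarrow> r \<le> R \<Longrightarrow> 2 * (1 + r) * r ^ N \<le> (1 - r)\<^sup>2"
    "\<And>r. R < r \<Longrightarrow> r < 1 \<Longrightarrow> (1 - r)\<^sup>2 < 2 * (1 + r) * r ^ N"
    by (rule bohr_equation_root[of 2 N]) (use assms in auto)
  obtain R' :: real where R': "0 < R'" "R' < 1" "\<And>r. r > 0 \<and> (1 + r) * r ^ N - (1 - r)\<^sup>2 = 0 \<longleftrightarrow> r = R'"
    "\<And>r. 0 \<le> r \<Longrightarrow> r \<le> R' \<Longrightarrow> (1 + r) * r ^ N \<le> (1 - r)\<^sup>2"
    "\<And>r. R' < r \<Longrightarrow> r < 1 \<Longrightarrow> (1 - r)\<^sup>2 < (1 + r) * r ^ N"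
    by (rule bohr_equation_root[of 1 N, simplified mult_1]) (use assms in auto)
  have eqR: "radius_R N = R" unfolding radius_R_def R(3) by simp
  have eqR': "radius_R' N = R'" unfolding radius_R'_def R'(3) by simp
  have a0: "a 0 = f 0" if "disc_series f a" for f a
  proof -
    have "(0::complex) \<in> ball 0 1" by simp
    then have "(\<lambda>n. a n * 0 ^ n) sums f 0" using that unfolding disc_series_def by blast
    then show ?thesis using powser_sums_zero[of a] sums_unique2 by blast
  qed
  have lt1: "cmod (f 0) < 1" if "f \<in> schur_class" for f
  proof -
    have "f 0 \<in> ball 0 1" using that unfolding schur_class_def by fastforce
    then show ?thesis by simp
  qed
  have linear: "cmod (f z) + refined_bohr_terms N a (cmod z) \<le> 1"
    if f: "f \<in> schur_class" and a: "disc_series f a" and z: "cmod z \<le> R" for f a z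
  proof -
    have z1: "cmod z < 1" using z R by simp
    show ?thesis
      using schwarz_pick_origin[OF f z1] refined_bohr_terms_le[OF f a assms _ z1]
        bohr_estimate_linear[OF _ lt1[OF f] _ z1 _ R(4)[OF _ z]]
      by (simp add: a0[OF a])
  qed
  have square: "(cmod (f z))\<^sup>2 + refined_bohr_terms N a (cmod z) \<le> 1"
    if f: "f \<in> schur_class" and a: "disc_series f a" and z: "cmod z \<le> R'" for f a z
  proof -
    have z1: "cmod z < 1" using z R' by simp
    have "(cmod (f z))\<^sup>2 \<le> ((cmod z + cmod (f 0)) / (1 + cmod (f 0) * cmod z))\<^sup>2"
      using schwarz_pick_origin[OF f z1] by (rule power_mono) simp
    moreover have "refined_bohr_terms N a (cmod z) \<le> (1 - (cmod (f 0))\<^sup>2) * cmod z ^ N / (1 - cmod z)"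
      using refined_bohr_terms_le[OF f a assms _ z1] by (simp add: a0[OF a])
    moreover have "((cmod z + cmod (f 0)) / (1 + cmod (f 0) * cmod z))\<^sup>2
        + (1 - (cmod (f 0))\<^sup>2) * cmod z ^ N / (1 - cmod z) \<le> 1"
      by (rule bohr_estimate_square[OF _ lt1[OF f] _ z1 _ R'(4)[OF _ z]]) auto
    ultimately show ?thesis by linarith
  qed
  have linear_sharp: "\<exists>f a z. f \<in> schur_class \<and> disc_series f a \<and> cmod z < 1 \<and> cmod z \<le> \<rho> \<and>
        \<not> cmod (f z) + refined_bohr_terms N a (cmod z) \<le> 1" if \<rho>: "\<rho> > R" for \<rho>
  proof -
    \<comment> \<open>The number \<rho> may exceed 1, so the radius of the counterexample is also
      taken below 1 to stay in the disc.\<close>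
    obtain r where r: "R < r" "r < min \<rho> 1" using dense[of R "min \<rho> 1"] \<rho> R by auto
    obtain f a where "f \<in> schur_class" "disc_series f a"
      "1 < cmod (f (of_real r)) + refined_bohr_terms N a r"
      using bohr_linear_sharp[OF _ _ assms R(5)] r R by auto
    then show ?thesis using r R
      by (intro exI[of _ f] exI[of _ a] exI[of _ "of_real r"]) auto
  qed
  have square_sharp: "\<exists>f a z. f \<in> schur_class \<and> disc_series f a \<and> cmod z < 1 \<and> cmod z \<le> \<rho> \<and>
        \<not> (cmod (f z))\<^sup>2 + refined_bohr_terms N a (cmod z) \<le> 1" if \<rho>: "\<rho> > R'" for \<rho>
  proof -
    obtain r where r: "R' < r" "r < min \<rho> 1" using dense[of R' "min \<rho> 1"] \<rho> R' by auto
    obtain f a where "f \<in> schur_class" "disc_series f a"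
      "1 < (cmod (f (of_real r)))\<^sup>2 + refined_bohr_terms N a r"
      using bohr_square_sharp[OF _ _ assms R'(5)] r R' by auto
    then show ?thesis using r R'
      by (intro exI[of _ f] exI[of _ a] exI[of _ "of_real r"]) auto
  qed
  show ?thesis
    unfolding eqR eqR' R(3) R'(3)
    using linear square linear_sharp square_sharp by blast
qed

end
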